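(* Let $\mathcal A$ and $\mathcal B$ be unital rings, and let $\mathcal M$ be an $(\mathcal A,\mathcal B)$-bimodule which is faithful as a left $\mathcal A$-module and also as a right $\mathcal B$-module. Let $\mathcal U=\mathrm{Tri}(\mathcal A,\mathcal M,\mathcal B)$ be the associated triangular ring. Then every generalized Jordan triple higher derivation of $\mathcal U$ is a generalized higher derivation.
   Context: $\mathbb N$ denotes the natural numbers including $0$; sums such as $\sum_{i+j=n}$ and $\sum_{i+j+k=n}$ range over $i,j,k\in\mathbb N$. Faithfulness of $\mathcal M$: for $a\in\mathcal A$ and $b\in\mathcal B$, $a\mathcal M=\{0\}$ implies $a=0$, and $\mathcal M b=\{0\}$ implies $b=0$. The triangular ring is $$\mathrm{Tri}(\mathcal A,\mathcal M,\mathcal B)=\left\{\begin{pmatrix} a & m\\ 0 & b\end{pmatrix}: a\in\mathcal A,\ m\in\mathcal M,\ b\in\mathcal B\right\}$$ with the usual matrix operations. Let $\mathcal R$ be a ring and let $D=(\tau_i)_{i\in\mathbb N}$ be a family of additive maps $\mathcal R\to\mathcal R$ with $\tau_0=\mathrm{id}_{\mathcal R}$. $D$ is a higher derivation if $\tau_n(AB)=\sum_{i+j=n}\tau_i(A)\tau_j(B)$ for all $n\in\mathbb N$ and $A,B\in\mathcal R$. $D$ is a Jordan triple higher derivation if $\tau_n(ABA)=\sum_{i+j+k=n}\tau_i(A)\tau_j(B)\tau_k(A)$ for all $n\in\mathbb N$ and $A,B\in\mathcal R$. Let $G=(\delta_i)_{i\in\mathbb N}$ be a family of additive maps $\mathcal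 R\to\mathcal R$ with $\delta_0=\mathrm{id}_{\mathcal R}$. $G$ is a generalized higher derivation if there exists a higher derivation $D=(\tau_i)_{i\in\mathbb N}$ of $\mathcal R$ such that $\delta_n(AB)=\sum_{i+j=n}\delta_i(A)\tau_j(B)$ for all $n\in\mathbb N$ and $A,B\in\mathcal R$. $G$ is a generalized Jordan triple higher derivation if there exists a Jordan triple higher derivation $D=(\tau_i)_{i\in\mathbb N}$ of $\mathcal R$ such that $\delta_n(ABA)=\sum_{i+j+k=n}\delta_i(A)\tau_j(B)\tau_k(A)$ for all $n\in\mathbb N$ and $A,B\in\mathcal R$. *)

theory Defs
  imports "HOL-Algebra.Module"
begin

text \<open>As for the library's \<open>module\<close> record, the multiplicative ring fields of a bimodule
  (\<open>mult\<close>, \<open>one\<close>) carry no meaning. The left action is the inherited \<open>smult\<close>.\<close>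

record ('a, 'b, 'm) bimodule = "('a, 'm) module" +
  rsmult :: "'m \<Rightarrow> 'b \<Rightarrow> 'm" (infixl "\<odot>\<^sub>r\<index>" 70)

text \<open>The locale \<open>ring\<close> is unital and admits the zero ring; the actions are unital.\<close>

locale bimodule = A: ring A + B: ring B + M: abelian_group M
  for A :: "('a, 'u) ring_scheme"
    and B :: "('b, 'v) ring_scheme"
    and M :: "('a, 'b, 'm, 'w) bimodule_scheme" +
  assumes smult_closed:
      "\<lbrakk>a \<in> carrier A; x \<in> carrier M\<rbrakk> \<Longrightarrow> a \<odot>\<^bsub>M\<^esub> x \<in> carrier M"
    and smult_l_distr:
      "\<lbrakk>a \<in> carrier A; a' \<in> carrier A; x \<in> carrier M\<rbrakk> \<Longrightarrow>
        (a \<oplus>\<^bsub>A\<^esub> a') \<odot>\<^bsub>M\<^esub> x = a \<odot>\<^bsub>M\<^esub> x \<oplus>\<^bsub>M\<^esub> a' \<odot>\<^bsub>M\<^esub> x"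
    and smult_r_distr:
      "\<lbrakk>a \<in> carrier A; x \<in> carrier M; y \<in> carrier M\<rbrakk> \<Longrightarrow>
        a \<odot>\<^bsub>M\<^esub> (x \<oplus>\<^bsub>M\<^esub> y) = a \<odot>\<^bsub>M\<^esub> x \<oplus>\<^bsub>M\<^esub> a \<odot>\<^bsub>M\<^esub> y"
    and smult_assoc:
      "\<lbrakk>a \<in> carrier A; a' \<in> carrier A; x \<in> carrier M\<rbrakk> \<Longrightarrow>
        (a \<otimes>\<^bsub>A\<^esub> a') \<odot>\<^bsub>M\<^esub> x = a \<odot>\<^bsub>M\<^esub> (a' \<odot>\<^bsub>M\<^esub> x)"
    and smult_one:
      "x \<in> carrier M \<Longrightarrow> \<one>\<^bsub>A\<^esub> \<odot>\<^bsub>M\<^esub> x = x"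
    and rsmult_closed:
      "\<lbrakk>x \<in> carrier M; b \<in> carrier B\<rbrakk> \<Longrightarrow> x \<odot>\<^sub>r\<^bsub>M\<^esub> b \<in> carrier M"
    and rsmult_l_distr:
      "\<lbrakk>x \<in> carrier M; y \<in> carrier M; b \<in> carrier B\<rbrakk> \<Longrightarrow>
        (x \<oplus>\<^bsub>M\<^esub> y) \<odot>\<^sub>r\<^bsub>M\<^esub> b = x \<odot>\<^sub>r\<^bsub>M\<^esub> b \<oplus>\<^bsub>M\<^esub> y \<odot>\<^sub>r\<^bsub>M\<^esub> b"
    and rsmult_r_distr:
      "\<lbrakk>x \<in> carrier M; b \<in> carrier B; b' \<in> carrier B\<rbrakk> \<Longrightarrow>
        x \<odot>\<^sub>r\<^bsub>M\<^esub> (b \<oplus>\<^bsub>B\<^esub> b') = x \<odot>\<^sub>r\<^bsub>M\<^esub> b \<oplus>\<^bsub>M\<^esub> x \<odot>\<^sub>r\<^bsub>M\<^esub> b'"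
    and rsmult_assoc:
      "\<lbrakk>x \<in> carrier M; b \<in> carrier B; b' \<in> carrier B\<rbrakk> \<Longrightarrow>
        x \<odot>\<^sub>r\<^bsub>M\<^esub> (b \<otimes>\<^bsub>B\<^esub> b') = (x \<odot>\<^sub>r\<^bsub>M\<^esub> b) \<odot>\<^sub>r\<^bsub>M\<^esub> b'"
    and rsmult_one:
      "x \<in> carrier M \<Longrightarrow> x \<odot>\<^sub>r\<^bsub>M\<^esub> \<one>\<^bsub>B\<^esub> = x"
    and smult_rsmult_assoc:
      "\<lbrakk>a \<in> carrier A; x \<in> carrier M; b \<in> carrier B\<rbrakk> \<Longrightarrow>
        (a \<odot>\<^bsub>M\<^esub> x) \<odot>\<^sub>r\<^bsub>M\<^esub> b = a \<odot>\<^bsub>M\<^esub> (x \<odot>\<^sub>r\<^bsub>M\<^esub> b)"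

definition left_faithful ::
  "('a, 'u) ring_scheme \<Rightarrow> ('a, 'b, 'm, 'w) bimodule_scheme \<Rightarrow> bool" where
  "left_faithful A M \<longleftrightarrow>
    (\<forall>a\<in>carrier A. (\<forall>x\<in>carrier M. a \<odot>\<^bsub>M\<^esub> x = \<zero>\<^bsub>M\<^esub>) \<longrightarrow> a = \<zero>\<^bsub>A\<^esub>)"

definition right_faithful ::
  "('b, 'v) ring_scheme \<Rightarrow> ('a, 'b, 'm, 'w) bimodule_scheme \<Rightarrow> bool" where
  "right_faithful B M \<longleftrightarrow>
    (\<forall>b\<in>carrier B. (\<forall>x\<in>carrier M. x \<odot>\<^sub>r\<^bsub>M\<^esub> b = \<zero>\<^bsub>M\<^esub>) \<longrightarrow> b = \<zero>\<^bsub>B\<^esub>)"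

text \<open>The triple \<open>(a, x, b)\<close> stands for the matrix with rows \<open>(a, x)\<close> and \<open>(0, b)\<close>.\<close>

definition Tri ::
  "('a, 'u) ring_scheme \<Rightarrow> ('a, 'b, 'm, 'w) bimodule_scheme \<Rightarrow> ('b, 'v) ring_scheme
    \<Rightarrow> ('a \<times> 'm \<times> 'b) ring" where
  "Tri A M B =
    \<lparr>carrier = carrier A \<times> carrier M \<times> carrier B,
     monoid.mult = (\<lambda>(a, x, b) (a', x', b').
       (a \<otimes>\<^bsub>A\<^esub> a', a \<odot>\<^bsub>M\<^esub> x' \<oplus>\<^bsub>M\<^esub> x \<odot>\<^sub>r\<^bsub>M\<^esub> b', b \<otimes>\<^bsub>B\<^esub> b')),
     one = (\<one>\<^bsub>A\<^esub>, \<zero>\<^bsub>M\<^esub>, \<one>\<^bsub>B\<^esub>),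
     ring.zero = (\<zero>\<^bsub>A\<^esub>, \<zero>\<^bsub>M\<^esub>, \<zero>\<^bsub>B\<^esub>),
     add = (\<lambda>(a, x, b) (a', x', b').
       (a \<oplus>\<^bsub>A\<^esub> a', x \<oplus>\<^bsub>M\<^esub> x', b \<oplus>\<^bsub>B\<^esub> b'))\<rparr>"

lemma (in bimodule) rsmult_zero:
  assumes "b \<in> carrier B" shows "\<zero>\<^bsub>M\<^esub> \<odot>\<^sub>r\<^bsub>M\<^esub> b = \<zero>\<^bsub>M\<^esub>"
  using rsmult_l_distr[of "\<zero>\<^bsub>M\<^esub>" "\<zero>\<^bsub>M\<^esub>" b] rsmult_closed[of "\<zero>\<^bsub>M\<^esub>" b] assms
  by (metis M.add.l_cancel_one' M.zero_closed M.l_zero)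

lemma (in bimodule) smult_zero:
  assumes "a \<in> carrier A" shows "a \<odot>\<^bsub>M\<^esub> \<zero>\<^bsub>M\<^esub> = \<zero>\<^bsub>M\<^esub>"
  using smult_r_distr[of a "\<zero>\<^bsub>M\<^esub>" "\<zero>\<^bsub>M\<^esub>"] smult_closed[of a "\<zero>\<^bsub>M\<^esub>"] assms
  by (metis M.add.l_cancel_one' M.zero_closed M.l_zero)

lemma (in bimodule) ring_Tri: "ring (Tri A M B)"
proof (rule ringI)
  show "abelian_group (Tri A M B)"
  proof (rule abelian_groupI)
    fix p assume p: "p \<in> carrier (Tri A M B)"
    obtain a x b where [simp]: "p = (a, x, b)" by (cases p)
    show "\<exists>q\<in>carrier (Tri A M B). q \<oplus>\<^bsub>Tri A M B\<^esub> p = \<zero>\<^bsub>Tri A M B\<^esub>"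
      using p by (intro bexI[of _ "(\<ominus>\<^bsub>A\<^esub> a, \<ominus>\<^bsub>M\<^esub> x, \<ominus>\<^bsub>B\<^esub> b)"])
        (auto simp: Tri_def A.l_neg M.l_neg B.l_neg)
  qed (auto simp: Tri_def A.a_ac M.a_ac B.a_ac)
  show "Group.monoid (Tri A M B)"
    by (rule monoidI)
      (auto simp: Tri_def A.m_assoc B.m_assoc smult_closed rsmult_closed smult_r_distr
        rsmult_l_distr smult_assoc rsmult_assoc smult_one rsmult_one smult_zero rsmult_zero
        smult_rsmult_assoc M.a_assoc)
qed (auto simp: Tri_def A.l_distr A.r_distr B.l_distr B.r_distr smult_closed rsmult_closed
    smult_l_distr smult_r_distr rsmult_l_distr rsmult_r_distr M.a_ac)

text \<open>Maps \<open>R \<rightarrow> R\<close> are HOL functions constrained only on \<open>carrier R\<close>; additive maps are the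
  homomorphisms of \<open>add_monoid R\<close>. Families start with the identity.\<close>

definition additive_family :: "('r, 'q) ring_scheme \<Rightarrow> (nat \<Rightarrow> 'r \<Rightarrow> 'r) \<Rightarrow> bool" where
  "additive_family R \<tau> \<longleftrightarrow>
    (\<forall>n. \<tau> n \<in> hom (add_monoid R) (add_monoid R)) \<and> (\<forall>X\<in>carrier R. \<tau> 0 X = X)"

definition higher_derivation :: "('r, 'q) ring_scheme \<Rightarrow> (nat \<Rightarrow> 'r \<Rightarrow> 'r) \<Rightarrow> bool" where
  "higher_derivation R \<tau> \<longleftrightarrow> additive_family R \<tau> \<and>
    (\<forall>n. \<forall>X\<in>carrier R. \<forall>Y\<in>carrier R.
      \<tau> n (X \<otimes>\<^bsub>R\<^esub> Y) =
        finsum R (\<lambda>(i, j). \<tau> i X \<otimes>\<^bsub>R\<^esub> \<tau> j Y)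
          {(i, j). i + j = n})"

definition jordan_triple_higher_derivation ::
  "('r, 'q) ring_scheme \<Rightarrow> (nat \<Rightarrow> 'r \<Rightarrow> 'r) \<Rightarrow> bool" where
  "jordan_triple_higher_derivation R \<tau> \<longleftrightarrow> additive_family R \<tau> \<and>
    (\<forall>n. \<forall>X\<in>carrier R. \<forall>Y\<in>carrier R.
      \<tau> n (X \<otimes>\<^bsub>R\<^esub> Y \<otimes>\<^bsub>R\<^esub> X) =
        finsum R (\<lambda>(i, j, k). \<tau> i X \<otimes>\<^bsub>R\<^esub> \<tau> j Y \<otimes>\<^bsub>R\<^esub> \<tau> k X)
          {(i, j, k). i + j + k = n})"

definition generalized_higher_derivation ::
  "('r, 'q) ring_scheme \<Rightarrow> (nat \<Rightarrow> 'r \<Rightarrow> 'r) \<Rightarrow> bool" where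
  "generalized_higher_derivation R \<delta> \<longleftrightarrow> additive_family R \<delta> \<and>
    (\<exists>\<tau>. higher_derivation R \<tau> \<and>
      (\<forall>n. \<forall>X\<in>carrier R. \<forall>Y\<in>carrier R.
        \<delta> n (X \<otimes>\<^bsub>R\<^esub> Y) =
          finsum R (\<lambda>(i, j). \<delta> i X \<otimes>\<^bsub>R\<^esub> \<tau> j Y)
            {(i, j). i + j = n}))"

definition generalized_jordan_triple_higher_derivation ::
  "('r, 'q) ring_scheme \<Rightarrow> (nat \<Rightarrow> 'r \<Rightarrow> 'r) \<Rightarrow> bool" where
  "generalized_jordan_triple_higher_derivation R \<delta> \<longleftrightarrow> additive_family R \<delta> \<and>
    (\<exists>\<tau>. jordan_triple_higher_derivation R \<tau> \<and>
      (\<forall>n. \<forall>X\<in>carrier R. \<forall>Y\<in>carrier R.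
        \<delta> n (X \<otimes>\<^bsub>R\<^esub> Y \<otimes>\<^bsub>R\<^esub> X) =
          finsum R (\<lambda>(i, j, k). \<delta> i X \<otimes>\<^bsub>R\<^esub> \<tau> j Y \<otimes>\<^bsub>R\<^esub> \<tau> k X)
            {(i, j, k). i + j + k = n}))"

end

theory Submission
  imports Defs "HOL-Algebra.Multiplicative_Group"
begin

text \<open>Let \<open>R\<close> be the triangular ring and encode a family \<open>(\<tau>\<^sub>n)\<close> as the single map
  \<open>T X = \<Sum>\<^sub>n \<tau>\<^sub>n(X) t\<^sup>n\<close> from \<open>R\<close> to the power series ring \<open>R[[t]]\<close>. Higher derivations become
  ring homomorphisms, Jordan triple higher derivations become additive maps with
  \<open>T(XYX) = T(X) T(Y) T(X)\<close>, and a generalized family \<open>\<delta>\<close> becomes an additive map \<open>D\<close> with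
  \<open>D(XYX) = D(X) T(Y) T(X)\<close>.

  The map \<open>T\<close> need not be a homomorphism. If \<open>\<epsilon> \<noteq> 0\<close> is central with \<open>2\<epsilon> = 0 = \<epsilon>\<^sup>2\<close>, then
  \<open>T X = (1 + \<epsilon>t)X\<close> is multiplicative on triples \<open>XYX\<close>, but it does not fix \<open>1\<close>. The remedy is to
  divide by \<open>u = T 1\<close>. The triple identity with both arguments \<open>1\<close> gives \<open>u\<^sup>3 = u\<close>, hence
  \<open>u\<^sup>2 = 1\<close> because \<open>u\<close> has constant term \<open>1\<close>
  (\<open>unit_series_square_one\<close>); the triple identity with outer argument \<open>1\<close> then shows that \<open>u\<close>
  commutes with the image of \<open>T\<close>. So \<open>\<sigma> X = T(X) u\<close> is again multiplicative on triples, and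
  \<open>\<sigma> 1 = 1\<close> (\<open>jordan_triple_hom_normalized\<close>).

  This \<open>\<sigma>\<close> is a homomorphism (\<open>hom_mult\<close>). Write \<open>e\<close>, \<open>f\<close> for the diagonal idempotents and
  \<open>E\<close>, \<open>F\<close> for their images, which are orthogonal idempotents with sum \<open>1\<close>. As
  \<open>\<sigma> X\<close> has constant term \<open>X\<close>, the lowest nonzero coefficient of an element of \<open>F R[[t]] E\<close> would
  lie in \<open>f R e = 0\<close>; so \<open>F R[[t]] E = 0\<close> and \<open>\<sigma>\<close> respects the Peirce decomposition. A product of
  an element of \<open>eRe\<close> with an element \<open>m\<close> of \<open>eRf\<close> vanishes in the other order, so it is a Jordan
  product and \<open>\<sigma>\<close> preserves it. Hence, for \<open>a\<close>, \<open>b\<close> in \<open>eRe\<close>, the difference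
  \<open>\<sigma>(ab) - \<sigma>(a)\<sigma>(b)\<close> annihilates every \<open>\<sigma>(m)\<close>; its lowest coefficient annihilates every \<open>m\<close> and
  is zero by faithfulness. The corner \<open>fRf\<close> is symmetric.

  Finally \<open>D(X) = D(1X1) = D(1) T(X) u = D(1) \<sigma>(X)\<close>, so
  \<open>D(XY) = D(1) \<sigma>(X) \<sigma>(Y) = D(X) \<sigma>(Y)\<close>: the coefficients of \<open>\<sigma>\<close>, in general not the given
  \<open>\<tau>\<close>, form the higher derivation that witnesses the claim.\<close>

section \<open>Power series over a ring\<close>

text \<open>The carrier ring is given by a record, so power series are built over records as well. The product is
  summed over the pairs that occur in the definition of a higher derivation.\<close>

definition power_series :: "('r, 'q) ring_scheme \<Rightarrow> (nat \<Rightarrow> 'r) ring" where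
  "power_series R =
    \<lparr>carrier = UNIV \<rightarrow> carrier R,
     monoid.mult = (\<lambda>x y n. finsum R (\<lambda>(i, j). x i \<otimes>\<^bsub>R\<^esub> y j) {(i, j). i + j = n}),
     one = (\<lambda>n. if n = 0 then \<one>\<^bsub>R\<^esub> else \<zero>\<^bsub>R\<^esub>),
     ring.zero = (\<lambda>n. \<zero>\<^bsub>R\<^esub>),
     add = (\<lambda>x y n. x n \<oplus>\<^bsub>R\<^esub> y n)\<rparr>"

lemma finite_pairs_with_sum: "finite {(i, j). i + j = (n::nat)}"
  by (rule finite_subset[of _ "{..n} \<times> {..n}"]) auto

lemma power_series_simps:
  "x \<in> carrier (power_series R) \<longleftrightarrow> (\<forall>n. x n \<in> carrier R)"
  "(x \<otimes>\<^bsub>power_series R\<^esub> y) n =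
    finsum R (\<lambda>(i, j). x i \<otimes>\<^bsub>R\<^esub> y j) {(i, j). i + j = n}"
  "\<one>\<^bsub>power_series R\<^esub> n = (if n = 0 then \<one>\<^bsub>R\<^esub> else \<zero>\<^bsub>R\<^esub>)"
  "\<zero>\<^bsub>power_series R\<^esub> n = \<zero>\<^bsub>R\<^esub>"
  "(x \<oplus>\<^bsub>power_series R\<^esub> y) n = x n \<oplus>\<^bsub>R\<^esub> y n"
  by (auto simp: power_series_def)

context ring
begin

abbreviation series ("\<S>") where "series \<equiv> power_series R"

lemma series_coeff_closed: "x \<in> carrier \<S> \<Longrightarrow> x n \<in> carrier R"
  by (simp add: power_series_simps)

lemma series_mult_closed:
  "\<lbrakk>x \<in> carrier \<S>; y \<in> carrier \<S>\<rbrakk> \<Longrightarrow> x \<otimes>\<^bsub>\<S>\<^esub> y \<in> carrier \<S>"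
  by (auto simp: power_series_simps intro!: finsum_closed)

lemma finsum_partition:
  assumes "finite I" "\<And>p. p \<in> I \<Longrightarrow> finite (A p)"
    and "\<And>p q. p \<in> I \<Longrightarrow> q \<in> I \<Longrightarrow> p \<noteq> q \<Longrightarrow> A p \<inter> A q = {}"
    and "\<And>p t. p \<in> I \<Longrightarrow> t \<in> A p \<Longrightarrow> g t \<in> carrier R"
    and "(\<Union>p\<in>I. A p) = C"
  shows "finsum R (\<lambda>p. finsum R g (A p)) I = finsum R g C"
  using add.finprod_UN_disjoint[of I A g] assms
  by (auto simp: pairwise_def disjnt_def)

text \<open>The coefficient of a triple product does not depend on the bracketing: this gives associativity of
  the power series product, and it matches the sums in the definition of a Jordan triple higher derivation.\<close>

lemma series_triple_coeff:
  assumes "x \<in> carrier \<S>" "y \<in> carrier \<S>" "z \<in> carrier \<S>"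
  shows "((x \<otimes>\<^bsub>\<S>\<^esub> y) \<otimes>\<^bsub>\<S>\<^esub> z) n =
    finsum R (\<lambda>(i, j, k). x i \<otimes> y j \<otimes> z k) {(i, j, k). i + j + k = n}"
proof -
  have c [simp]: "x i \<in> carrier R" "y i \<in> carrier R" "z i \<in> carrier R" for i
    using assms by (auto simp: series_coeff_closed)
  let ?g = "\<lambda>(i, j, k). x i \<otimes> y j \<otimes> z k"
  let ?A = "\<lambda>p. (\<lambda>(i, j). (i, j, snd p)) ` {(i, j). i + j = fst p}"
  have inner: "finsum R (\<lambda>(i, j). x i \<otimes> y j) {(i, j). i + j = fst p} \<otimes> z (snd p)
      = finsum R ?g (?A p)" for p :: "nat \<times> nat"
  proof -
    have "finsum R (\<lambda>(i, j). x i \<otimes> y j) {(i, j). i + j = fst p} \<otimes> z (snd p)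
        = finsum R (\<lambda>q. (case q of (i, j) \<Rightarrow> x i \<otimes> y j) \<otimes> z (snd p)) {(i, j). i + j = fst p}"
      by (rule finsum_ldistr) (auto simp: finite_pairs_with_sum)
    also have "\<dots> = finsum R (\<lambda>q. ?g (case q of (i, j) \<Rightarrow> (i, j, snd p))) {(i, j). i + j = fst p}"
      by (rule finsum_cong') auto
    also have "\<dots> = finsum R ?g (?A p)"
      by (rule finsum_reindex[symmetric]) (auto simp: inj_on_def)
    finally show ?thesis .
  qed
  have "((x \<otimes>\<^bsub>\<S>\<^esub> y) \<otimes>\<^bsub>\<S>\<^esub> z) n = finsum R (\<lambda>p. finsum R ?g (?A p)) {(i, j). i + j = n}"
    unfolding inner[symmetric]
    by (auto simp: power_series_simps case_prod_unfold intro!: finsum_cong')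
  also have "\<dots> = finsum R ?g {(i, j, k). i + j + k = n}"
    by (rule finsum_partition) (auto simp: finite_pairs_with_sum image_iff)
  finally show ?thesis .
qed

lemma series_triple_coeff_right:
  assumes "x \<in> carrier \<S>" "y \<in> carrier \<S>" "z \<in> carrier \<S>"
  shows "(x \<otimes>\<^bsub>\<S>\<^esub> (y \<otimes>\<^bsub>\<S>\<^esub> z)) n =
    finsum R (\<lambda>(i, j, k). x i \<otimes> y j \<otimes> z k) {(i, j, k). i + j + k = n}"
proof -
  have c [simp]: "x i \<in> carrier R" "y i \<in> carrier R" "z i \<in> carrier R" for i
    using assms by (auto simp: series_coeff_closed)
  let ?g = "\<lambda>(i, j, k). x i \<otimes> y j \<otimes> z k"
  let ?A = "\<lambda>p. (\<lambda>(j, k). (fst p, j, k)) ` {(j, k). j + k = snd p}"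
  have inner: "x (fst p) \<otimes> finsum R (\<lambda>(j, k). y j \<otimes> z k) {(j, k). j + k = snd p}
      = finsum R ?g (?A p)" for p :: "nat \<times> nat"
  proof -
    have "x (fst p) \<otimes> finsum R (\<lambda>(j, k). y j \<otimes> z k) {(j, k). j + k = snd p}
        = finsum R (\<lambda>q. x (fst p) \<otimes> (case q of (j, k) \<Rightarrow> y j \<otimes> z k)) {(j, k). j + k = snd p}"
      by (rule finsum_rdistr) (auto simp: finite_pairs_with_sum)
    also have "\<dots> = finsum R (\<lambda>q. ?g (case q of (j, k) \<Rightarrow> (fst p, j, k))) {(j, k). j + k = snd p}"
      by (rule finsum_cong') (auto simp: m_assoc)
    also have "\<dots> = finsum R ?g (?A p)"
      by (rule finsum_reindex[symmetric]) (auto simp: inj_on_def)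
    finally show ?thesis .
  qed
  have "(x \<otimes>\<^bsub>\<S>\<^esub> (y \<otimes>\<^bsub>\<S>\<^esub> z)) n = finsum R (\<lambda>p. finsum R ?g (?A p)) {(i, j). i + j = n}"
    unfolding inner[symmetric]
    by (auto simp: power_series_simps case_prod_unfold intro!: finsum_cong')
  also have "\<dots> = finsum R ?g {(i, j, k). i + j + k = n}"
    by (rule finsum_partition) (auto simp: finite_pairs_with_sum image_iff)
  finally show ?thesis .
qed

lemma series_coeff_single_term:
  assumes "x \<in> carrier \<S>" "y \<in> carrier \<S>"
    and "\<And>i j. i + j = a + b \<Longrightarrow> i \<noteq> a \<Longrightarrow> x i \<otimes> y j = \<zero>"
  shows "(x \<otimes>\<^bsub>\<S>\<^esub> y) (a + b) = x a \<otimes> y b"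
proof -
  have c [simp]: "x i \<in> carrier R" "y i \<in> carrier R" for i
    using assms by (auto simp: series_coeff_closed)
  have "(x \<otimes>\<^bsub>\<S>\<^esub> y) (a + b) = finsum R (\<lambda>(i, j). x i \<otimes> y j) {(a, b)}"
    unfolding power_series_simps
    by (rule add.finprod_mono_neutral_cong_right)
      (auto simp: finite_pairs_with_sum intro: assms(3))
  then show ?thesis
    by simp
qed

lemma series_lowest_coeff_l:
  assumes "x \<in> carrier \<S>" "y \<in> carrier \<S>" "\<And>k. k < n \<Longrightarrow> x k = \<zero>"
  shows "(x \<otimes>\<^bsub>\<S>\<^esub> y) n = x n \<otimes> y 0"
  using series_coeff_single_term[of x y n 0] assms
  by (force simp: series_coeff_closed)

lemma series_lowest_coeff_r:
  assumes "x \<in> carrier \<S>" "y \<in> carrier \<S>" "\<And>k. k < n \<Longrightarrow> y k = \<zero>"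
  shows "(x \<otimes>\<^bsub>\<S>\<^esub> y) n = x 0 \<otimes> y n"
  using series_coeff_single_term[of x y 0 n] assms
  by (force simp: series_coeff_closed)

lemma ring_series: "ring \<S>"
proof (rule ringI)
  have one: "\<one>\<^bsub>\<S>\<^esub> \<in> carrier \<S>"
    by (simp add: power_series_simps)
  show "abelian_group \<S>"
  proof (rule abelian_groupI)
    fix x assume "x \<in> carrier \<S>"
    then show "\<exists>y\<in>carrier \<S>. y \<oplus>\<^bsub>\<S>\<^esub> x = \<zero>\<^bsub>\<S>\<^esub>"
      by (intro bexI[of _ "\<lambda>n. \<ominus> x n"]) (auto simp: power_series_simps fun_eq_iff l_neg)
  qed (auto simp: power_series_simps fun_eq_iff a_ac)
  show "Group.monoid \<S>"
  proof (rule monoidI)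
    fix x y z assume "x \<in> carrier \<S>" "y \<in> carrier \<S>" "z \<in> carrier \<S>"
    then show "x \<otimes>\<^bsub>\<S>\<^esub> y \<otimes>\<^bsub>\<S>\<^esub> z = x \<otimes>\<^bsub>\<S>\<^esub> (y \<otimes>\<^bsub>\<S>\<^esub> z)"
      by (simp add: fun_eq_iff series_triple_coeff series_triple_coeff_right)
  next
    fix x assume x: "x \<in> carrier \<S>"
    show "\<one>\<^bsub>\<S>\<^esub> \<otimes>\<^bsub>\<S>\<^esub> x = x"
      using series_coeff_single_term[OF one x, of 0] x
      by (auto simp: fun_eq_iff power_series_simps(3) series_coeff_closed)
    show "x \<otimes>\<^bsub>\<S>\<^esub> \<one>\<^bsub>\<S>\<^esub> = x"
      using series_coeff_single_term[OF x one, of _ 0] x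
      by (auto simp: fun_eq_iff power_series_simps(3) series_coeff_closed)
  qed (auto simp: one series_mult_closed)
  fix x y z assume "x \<in> carrier \<S>" "y \<in> carrier \<S>" "z \<in> carrier \<S>"
  then have c: "x i \<in> carrier R" "y i \<in> carrier R" "z i \<in> carrier R" for i
    by (auto simp: series_coeff_closed)
  show "(x \<oplus>\<^bsub>\<S>\<^esub> y) \<otimes>\<^bsub>\<S>\<^esub> z = x \<otimes>\<^bsub>\<S>\<^esub> z \<oplus>\<^bsub>\<S>\<^esub> y \<otimes>\<^bsub>\<S>\<^esub> z"
    by (rule ext, unfold power_series_simps, subst finsum_addf[symmetric])
      (use c in \<open>auto simp: l_distr intro!: finsum_cong'\<close>)
  show "z \<otimes>\<^bsub>\<S>\<^esub> (x \<oplus>\<^bsub>\<S>\<^esub> y) = z \<otimes>\<^bsub>\<S>\<^esub> x \<oplus>\<^bsub>\<S>\<^esub> z \<otimes>\<^bsub>\<S>\<^esub> y"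
    by (rule ext, unfold power_series_simps, subst finsum_addf[symmetric])
      (use c in \<open>auto simp: r_distr intro!: finsum_cong'\<close>)
qed

text \<open>All vanishing results for power series below come from this: it is enough to show that
  a coefficient is zero when all lower ones are, and such a lowest coefficient of a factor
  meets only the constant terms of the other factors.\<close>

lemma series_zeroI:
  assumes "\<And>n. (\<And>k. k < n \<Longrightarrow> x k = \<zero>) \<Longrightarrow> x n = \<zero>"
  shows "x = \<zero>\<^bsub>\<S>\<^esub>"
proof
  fix n
  show "x n = \<zero>\<^bsub>\<S>\<^esub> n"
    unfolding power_series_simps
    by (induction n rule: less_induct) (rule assms)
qed

lemma series_sandwich_lowest_coeff:
  assumes "x \<in> carrier \<S>" "y \<in> carrier \<S>" "z \<in> carrier \<S>" "\<And>k. k < n \<Longrightarrow> y k = \<zero>"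
  shows "(x \<otimes>\<^bsub>\<S>\<^esub> y \<otimes>\<^bsub>\<S>\<^esub> z) n = x 0 \<otimes> y n \<otimes> z 0"
proof -
  have low: "(x \<otimes>\<^bsub>\<S>\<^esub> y) k = x 0 \<otimes> y k" if "k \<le> n" for k
    using that assms by (intro series_lowest_coeff_r) auto
  have "(x \<otimes>\<^bsub>\<S>\<^esub> y) k = \<zero>" if "k < n" for k
    using low[of k] that assms by (simp add: series_coeff_closed)
  then show ?thesis
    using series_lowest_coeff_l[of "x \<otimes>\<^bsub>\<S>\<^esub> y" z n] low[of n] assms
    by (simp add: series_mult_closed)
qed

lemma series_cancel_const_one:
  assumes "x \<in> carrier \<S>" "u \<in> carrier \<S>" "u 0 = \<one>" "x \<otimes>\<^bsub>\<S>\<^esub> u = \<zero>\<^bsub>\<S>\<^esub>"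
  shows "x = \<zero>\<^bsub>\<S>\<^esub>"
proof (rule series_zeroI)
  fix n assume "\<And>k. k < n \<Longrightarrow> x k = \<zero>"
  then have "(x \<otimes>\<^bsub>\<S>\<^esub> u) n = x n \<otimes> u 0"
    using assms by (intro series_lowest_coeff_l) auto
  then show "x n = \<zero>"
    using assms by (simp add: power_series_simps)
qed

end

section \<open>Jordan triple homomorphisms\<close>

text \<open>The inner form of a triangular matrix ring with a faithful bimodule: the diagonal rings are
  the corners of \<open>e\<close> and \<open>f\<close>, and the bimodule is the corner between \<open>e\<close> and \<open>f\<close>.\<close>

locale triangular_ring = ring R for R (structure) +
  fixes e f
  assumes idem_closed: "e \<in> carrier R" "f \<in> carrier R"
    and idem: "e \<otimes> e = e" "f \<otimes> f = f"
    and orth: "e \<otimes> f = \<zero>" "f \<otimes> e = \<zero>"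
    and idem_sum: "e \<oplus> f = \<one>"
    and lower_corner: "X \<in> carrier R \<Longrightarrow> f \<otimes> X \<otimes> e = \<zero>"
    and corner_faithful_l:
      "\<lbrakk>X \<in> carrier R; \<And>Y. Y \<in> carrier R \<Longrightarrow> (e \<otimes> X \<otimes> e) \<otimes> (e \<otimes> Y \<otimes> f) = \<zero>\<rbrakk> \<Longrightarrow>
        e \<otimes> X \<otimes> e = \<zero>"
    and corner_faithful_r:
      "\<lbrakk>X \<in> carrier R; \<And>Y. Y \<in> carrier R \<Longrightarrow> (e \<otimes> Y \<otimes> f) \<otimes> (f \<otimes> X \<otimes> f) = \<zero>\<rbrakk> \<Longrightarrow>
        f \<otimes> X \<otimes> f = \<zero>"

locale jordan_triple_map = R: ring R + S: ring S
  for R :: "('r, 'q) ring_scheme" and S :: "('s, 'p) ring_scheme" +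
  fixes \<phi> :: "'r \<Rightarrow> 's"
  assumes closed: "X \<in> carrier R \<Longrightarrow> \<phi> X \<in> carrier S"
    and add: "\<lbrakk>X \<in> carrier R; Y \<in> carrier R\<rbrakk> \<Longrightarrow> \<phi> (X \<oplus>\<^bsub>R\<^esub> Y) = \<phi> X \<oplus>\<^bsub>S\<^esub> \<phi> Y"
    and triple: "\<lbrakk>X \<in> carrier R; Y \<in> carrier R\<rbrakk> \<Longrightarrow>
      \<phi> (X \<otimes>\<^bsub>R\<^esub> Y \<otimes>\<^bsub>R\<^esub> X) = \<phi> X \<otimes>\<^bsub>S\<^esub> \<phi> Y \<otimes>\<^bsub>S\<^esub> \<phi> X"
begin

lemma linearized_triple:
  assumes [simp]: "X \<in> carrier R" "Y \<in> carrier R" "Z \<in> carrier R"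
  shows "\<phi> (X \<otimes>\<^bsub>R\<^esub> Y \<otimes>\<^bsub>R\<^esub> Z \<oplus>\<^bsub>R\<^esub> Z \<otimes>\<^bsub>R\<^esub> Y \<otimes>\<^bsub>R\<^esub> X) =
    \<phi> X \<otimes>\<^bsub>S\<^esub> \<phi> Y \<otimes>\<^bsub>S\<^esub> \<phi> Z \<oplus>\<^bsub>S\<^esub> \<phi> Z \<otimes>\<^bsub>S\<^esub> \<phi> Y \<otimes>\<^bsub>S\<^esub> \<phi> X"
proof -
  note [simp] = closed
  let ?m = "X \<otimes>\<^bsub>R\<^esub> Y \<otimes>\<^bsub>R\<^esub> Z \<oplus>\<^bsub>R\<^esub> Z \<otimes>\<^bsub>R\<^esub> Y \<otimes>\<^bsub>R\<^esub> X"
  let ?d = "X \<otimes>\<^bsub>R\<^esub> Y \<otimes>\<^bsub>R\<^esub> X \<oplus>\<^bsub>R\<^esub> Z \<otimes>\<^bsub>R\<^esub> Y \<otimes>\<^bsub>R\<^esub> Z"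
  let ?m' = "\<phi> X \<otimes>\<^bsub>S\<^esub> \<phi> Y \<otimes>\<^bsub>S\<^esub> \<phi> Z \<oplus>\<^bsub>S\<^esub> \<phi> Z \<otimes>\<^bsub>S\<^esub> \<phi> Y \<otimes>\<^bsub>S\<^esub> \<phi> X"
  have "\<phi> ?m \<oplus>\<^bsub>S\<^esub> \<phi> ?d = \<phi> ((X \<oplus>\<^bsub>R\<^esub> Z) \<otimes>\<^bsub>R\<^esub> Y \<otimes>\<^bsub>R\<^esub> (X \<oplus>\<^bsub>R\<^esub> Z))"
    by (subst add[symmetric]) (simp_all add: R.l_distr R.r_distr R.a_ac)
  also have "\<dots> = ?m' \<oplus>\<^bsub>S\<^esub> \<phi> ?d"
    by (subst triple) (simp_all add: add triple S.l_distr S.r_distr S.a_ac)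
  finally show ?thesis
    by (subst (asm) S.add.right_cancel) simp_all
qed

end

locale jordan_triple_hom = jordan_triple_map +
  assumes unital: "\<phi> \<one>\<^bsub>R\<^esub> = \<one>\<^bsub>S\<^esub>"
begin

lemma jordan_product:
  assumes "X \<in> carrier R" "Y \<in> carrier R"
  shows "\<phi> (X \<otimes>\<^bsub>R\<^esub> Y \<oplus>\<^bsub>R\<^esub> Y \<otimes>\<^bsub>R\<^esub> X) =
    \<phi> X \<otimes>\<^bsub>S\<^esub> \<phi> Y \<oplus>\<^bsub>S\<^esub> \<phi> Y \<otimes>\<^bsub>S\<^esub> \<phi> X"
  using linearized_triple[of X "\<one>\<^bsub>R\<^esub>" Y] assms closed by (simp add: unital)

lemma idempotent:
  assumes "p \<in> carrier R" "p \<otimes>\<^bsub>R\<^esub> p = p"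
  shows "\<phi> p \<otimes>\<^bsub>S\<^esub> \<phi> p = \<phi> p"
  using triple[of p "\<one>\<^bsub>R\<^esub>"] assms closed by (simp add: unital)

end

text \<open>What a target ring must inherit for a unital Jordan triple map to be multiplicative. Faithfulness
  is required only against the image of the bimodule corner, so that it can be checked
  for power series by looking at a lowest coefficient.\<close>

locale triangular_jordan_hom = triangular_ring R e f + jordan_triple_hom R S \<phi>
  for R :: "('r, 'q) ring_scheme" (structure) and e f
    and S :: "('s, 'p) ring_scheme" and \<phi> :: "'r \<Rightarrow> 's" +
  assumes image_lower_corner: "z \<in> carrier S \<Longrightarrow> \<phi> f \<otimes>\<^bsub>S\<^esub> z \<otimes>\<^bsub>S\<^esub> \<phi> e = \<zero>\<^bsub>S\<^esub>"
    and image_faithful_l: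
      "\<lbrakk>z \<in> carrier S; z = \<phi> e \<otimes>\<^bsub>S\<^esub> z \<otimes>\<^bsub>S\<^esub> \<phi> e;
        \<And>Y. Y \<in> carrier R \<Longrightarrow> z \<otimes>\<^bsub>S\<^esub> \<phi> (e \<otimes> Y \<otimes> f) = \<zero>\<^bsub>S\<^esub>\<rbrakk> \<Longrightarrow> z = \<zero>\<^bsub>S\<^esub>"
    and image_faithful_r:
      "\<lbrakk>z \<in> carrier S; z = \<phi> f \<otimes>\<^bsub>S\<^esub> z \<otimes>\<^bsub>S\<^esub> \<phi> f;
        \<And>Y. Y \<in> carrier R \<Longrightarrow> \<phi> (e \<otimes> Y \<otimes> f) \<otimes>\<^bsub>S\<^esub> z = \<zero>\<^bsub>S\<^esub>\<rbrakk> \<Longrightarrow> z = \<zero>\<^bsub>S\<^esub>"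
begin

abbreviation image_mult (infixl "\<cdot>" 70) where "x \<cdot> y \<equiv> x \<otimes>\<^bsub>S\<^esub> y"
abbreviation E where "E \<equiv> \<phi> e"
abbreviation F where "F \<equiv> \<phi> f"

lemma image_idem_sum: "E \<oplus>\<^bsub>S\<^esub> F = \<one>\<^bsub>S\<^esub>"
  using add[of e f] idem_closed by (simp add: idem_sum unital)

lemma image_idem: "E \<cdot> E = E" "F \<cdot> F = F"
  using idempotent idem idem_closed by auto

lemma image_closed: "E \<in> carrier S" "F \<in> carrier S"
  using closed idem_closed by auto

lemma image_orth: "E \<cdot> F = \<zero>\<^bsub>S\<^esub>" "F \<cdot> E = \<zero>\<^bsub>S\<^esub>"
proof -
  note [simp] = image_closed
  have "E \<cdot> E \<oplus>\<^bsub>S\<^esub> E \<cdot> F = E"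
    by (simp add: S.r_distr[symmetric] image_idem_sum)
  then show "E \<cdot> F = \<zero>\<^bsub>S\<^esub>"
    by (simp add: image_idem)
  have "E \<cdot> E \<oplus>\<^bsub>S\<^esub> F \<cdot> E = E"
    by (simp add: S.l_distr[symmetric] image_idem_sum)
  then show "F \<cdot> E = \<zero>\<^bsub>S\<^esub>"
    by (simp add: image_idem)
qed

lemma corner_simps:
  assumes "z \<in> carrier S"
  shows "E \<cdot> (E \<cdot> z) = E \<cdot> z" "F \<cdot> (F \<cdot> z) = F \<cdot> z"
    "E \<cdot> (F \<cdot> z) = \<zero>\<^bsub>S\<^esub>" "F \<cdot> (E \<cdot> z) = \<zero>\<^bsub>S\<^esub>" "F \<cdot> (z \<cdot> E) = \<zero>\<^bsub>S\<^esub>"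
  using assms image_closed image_idem image_orth image_lower_corner[of z]
  by (simp_all add: S.m_assoc[symmetric])

lemma base_corner_simps:
  assumes "X \<in> carrier R"
  shows "e \<otimes> (e \<otimes> X) = e \<otimes> X" "f \<otimes> (f \<otimes> X) = f \<otimes> X"
    "e \<otimes> (f \<otimes> X) = \<zero>" "f \<otimes> (e \<otimes> X) = \<zero>" "f \<otimes> (X \<otimes> e) = \<zero>"
  using assms idem_closed idem orth lower_corner[of X]
  by (simp_all add: m_assoc[symmetric])

lemma corner_ee: "X \<in> carrier R \<Longrightarrow> \<phi> (e \<otimes> X \<otimes> e) = E \<cdot> \<phi> X \<cdot> E"
  and corner_ff: "X \<in> carrier R \<Longrightarrow> \<phi> (f \<otimes> X \<otimes> f) = F \<cdot> \<phi> X \<cdot> F"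
  using triple idem_closed by auto

text \<open>Linearization controls only the sum of the two off-diagonal parts; the lower ones
  vanish on both sides.\<close>

lemma corner_ef:
  assumes "X \<in> carrier R"
  shows "\<phi> (e \<otimes> X \<otimes> f) = E \<cdot> \<phi> X \<cdot> F"
  using linearized_triple[of e X f] assms idem_closed closed
  by (simp add: lower_corner image_lower_corner)

text \<open>In the reverse order the product is zero both before and after applying the map, so the
  Jordan product is the product itself.\<close>

lemma module_mult_l:
  assumes "X \<in> carrier R" "Y \<in> carrier R"
  shows "\<phi> ((e \<otimes> X \<otimes> e) \<otimes> (e \<otimes> Y \<otimes> f)) = \<phi> (e \<otimes> X \<otimes> e) \<cdot> \<phi> (e \<otimes> Y \<otimes> f)"
proof -
  note [simp] = assms idem_closed image_closed closed
  have "(e \<otimes> Y \<otimes> f) \<otimes> (e \<otimes> X \<otimes> e) = \<zero>"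
    by (simp add: m_assoc base_corner_simps)
  moreover have "\<phi> (e \<otimes> Y \<otimes> f) \<cdot> \<phi> (e \<otimes> X \<otimes> e) = \<zero>\<^bsub>S\<^esub>"
    by (simp add: corner_ee corner_ef S.m_assoc corner_simps)
  ultimately show ?thesis
    using jordan_product[of "e \<otimes> X \<otimes> e" "e \<otimes> Y \<otimes> f"] by simp
qed

lemma module_mult_r:
  assumes "X \<in> carrier R" "Y \<in> carrier R"
  shows "\<phi> ((e \<otimes> X \<otimes> f) \<otimes> (f \<otimes> Y \<otimes> f)) = \<phi> (e \<otimes> X \<otimes> f) \<cdot> \<phi> (f \<otimes> Y \<otimes> f)"
proof -
  note [simp] = assms idem_closed image_closed closed
  have "(f \<otimes> Y \<otimes> f) \<otimes> (e \<otimes> X \<otimes> f) = \<zero>"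
    by (simp add: m_assoc base_corner_simps)
  moreover have "\<phi> (f \<otimes> Y \<otimes> f) \<cdot> \<phi> (e \<otimes> X \<otimes> f) = \<zero>\<^bsub>S\<^esub>"
    by (simp add: corner_ff corner_ef S.m_assoc corner_simps)
  ultimately show ?thesis
    using jordan_product[of "e \<otimes> X \<otimes> f" "f \<otimes> Y \<otimes> f"] by simp
qed

text \<open>Associativity of the action on the bimodule corner forces the difference of the two sides to
  annihilate the image of that corner.\<close>

lemma corner_mult_ee:
  assumes "X \<in> carrier R" "Y \<in> carrier R"
  shows "\<phi> ((e \<otimes> X \<otimes> e) \<otimes> (e \<otimes> Y \<otimes> e)) = \<phi> (e \<otimes> X \<otimes> e) \<cdot> \<phi> (e \<otimes> Y \<otimes> e)"
proof -
  note [simp] = assms idem_closed image_closed closed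
  let ?a = "e \<otimes> X \<otimes> e" and ?b = "e \<otimes> Y \<otimes> e"
  let ?z = "\<phi> (?a \<otimes> ?b) \<ominus>\<^bsub>S\<^esub> \<phi> ?a \<cdot> \<phi> ?b"
  have ab: "?a \<otimes> ?b = e \<otimes> (X \<otimes> e \<otimes> Y) \<otimes> e"
    by (simp add: m_assoc base_corner_simps)
  have "?z = \<zero>\<^bsub>S\<^esub>"
  proof (rule image_faithful_l)
    show "?z = E \<cdot> ?z \<cdot> E"
      unfolding ab
      by (simp add: corner_ee S.minus_eq S.l_distr S.r_distr S.l_minus S.r_minus S.m_assoc
        corner_simps image_idem)
    fix W assume [simp]: "W \<in> carrier R"
    let ?m = "e \<otimes> W \<otimes> f"
    have bm: "?b \<otimes> ?m = e \<otimes> (Y \<otimes> e \<otimes> W) \<otimes> f"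
      by (simp add: m_assoc base_corner_simps)
    have "\<phi> (?a \<otimes> ?b) \<cdot> \<phi> ?m = \<phi> (?a \<otimes> ?b \<otimes> ?m)"
      unfolding ab by (rule module_mult_l[symmetric]) simp_all
    also have "\<dots> = \<phi> (?a \<otimes> (?b \<otimes> ?m))"
      by (simp add: m_assoc)
    also have "\<dots> = \<phi> ?a \<cdot> \<phi> (?b \<otimes> ?m)"
      unfolding bm by (rule module_mult_l) simp_all
    also have "\<dots> = \<phi> ?a \<cdot> \<phi> ?b \<cdot> \<phi> ?m"
      by (subst module_mult_l) (simp_all add: S.m_assoc)
    finally show "?z \<cdot> \<phi> ?m = \<zero>\<^bsub>S\<^esub>"
      by (simp add: S.minus_eq S.l_distr S.l_minus S.r_neg)
  qed simp
  then show ?thesis by (simp)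
qed

lemma corner_mult_ff:
  assumes "X \<in> carrier R" "Y \<in> carrier R"
  shows "\<phi> ((f \<otimes> X \<otimes> f) \<otimes> (f \<otimes> Y \<otimes> f)) = \<phi> (f \<otimes> X \<otimes> f) \<cdot> \<phi> (f \<otimes> Y \<otimes> f)"
proof -
  note [simp] = assms idem_closed image_closed closed
  let ?a = "f \<otimes> X \<otimes> f" and ?b = "f \<otimes> Y \<otimes> f"
  let ?z = "\<phi> (?a \<otimes> ?b) \<ominus>\<^bsub>S\<^esub> \<phi> ?a \<cdot> \<phi> ?b"
  have ab: "?a \<otimes> ?b = f \<otimes> (X \<otimes> f \<otimes> Y) \<otimes> f"
    by (simp add: m_assoc base_corner_simps)
  have "?z = \<zero>\<^bsub>S\<^esub>"
  proof (rule image_faithful_r)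
    show "?z = F \<cdot> ?z \<cdot> F"
      unfolding ab
      by (simp add: corner_ff S.minus_eq S.l_distr S.r_distr S.l_minus S.r_minus S.m_assoc
        corner_simps image_idem)
    fix W assume [simp]: "W \<in> carrier R"
    let ?m = "e \<otimes> W \<otimes> f"
    have ma: "?m \<otimes> ?a = e \<otimes> (W \<otimes> f \<otimes> X) \<otimes> f"
      by (simp add: m_assoc base_corner_simps)
    have "\<phi> ?m \<cdot> \<phi> (?a \<otimes> ?b) = \<phi> (?m \<otimes> (?a \<otimes> ?b))"
      unfolding ab by (rule module_mult_r[symmetric]) simp_all
    also have "\<dots> = \<phi> ((?m \<otimes> ?a) \<otimes> ?b)"
      by (simp add: m_assoc)
    also have "\<dots> = \<phi> (?m \<otimes> ?a) \<cdot> \<phi> ?b"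
      unfolding ma by (rule module_mult_r) simp_all
    also have "\<dots> = \<phi> ?m \<cdot> (\<phi> ?a \<cdot> \<phi> ?b)"
      by (subst module_mult_r) (simp_all add: S.m_assoc)
    finally show "\<phi> ?m \<cdot> ?z = \<zero>\<^bsub>S\<^esub>"
      by (simp add: S.minus_eq S.r_distr S.r_minus S.r_neg)
  qed simp
  then show ?thesis by (simp)
qed

lemma insert_idem_sum:
  assumes "p \<in> carrier R" "X \<in> carrier R" "Y \<in> carrier R" "q \<in> carrier R"
  shows "p \<otimes> (X \<otimes> Y) \<otimes> q = (p \<otimes> X \<otimes> e) \<otimes> (e \<otimes> Y \<otimes> q) \<oplus> (p \<otimes> X \<otimes> f) \<otimes> (f \<otimes> Y \<otimes> q)"
proof -
  note [simp] = assms idem_closed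
  have "p \<otimes> (X \<otimes> Y) \<otimes> q = p \<otimes> X \<otimes> (e \<oplus> f) \<otimes> (Y \<otimes> q)"
    by (simp add: idem_sum m_assoc)
  also have "\<dots> = (p \<otimes> X \<otimes> e) \<otimes> (e \<otimes> Y \<otimes> q) \<oplus> (p \<otimes> X \<otimes> f) \<otimes> (f \<otimes> Y \<otimes> q)"
    by (simp only: r_distr l_distr m_closed assms idem_closed)
      (simp add: m_assoc base_corner_simps)
  finally show ?thesis .
qed

lemma insert_image_idem_sum:
  assumes "p \<in> carrier S" "x \<in> carrier S" "y \<in> carrier S" "q \<in> carrier S"
  shows "p \<cdot> (x \<cdot> y) \<cdot> q = (p \<cdot> x \<cdot> E) \<cdot> (E \<cdot> y \<cdot> q) \<oplus>\<^bsub>S\<^esub> (p \<cdot> x \<cdot> F) \<cdot> (F \<cdot> y \<cdot> q)"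
proof -
  note [simp] = assms image_closed
  have "p \<cdot> (x \<cdot> y) \<cdot> q = p \<cdot> x \<cdot> (E \<oplus>\<^bsub>S\<^esub> F) \<cdot> (y \<cdot> q)"
    by (simp add: image_idem_sum S.m_assoc)
  also have "\<dots> = (p \<cdot> x \<cdot> E) \<cdot> (E \<cdot> y \<cdot> q) \<oplus>\<^bsub>S\<^esub> (p \<cdot> x \<cdot> F) \<cdot> (F \<cdot> y \<cdot> q)"
    by (simp only: S.r_distr S.l_distr S.m_closed assms image_closed)
      (simp add: S.m_assoc corner_simps)
  finally show ?thesis .
qed

lemma peirce_decomposition:
  assumes "z \<in> carrier S"
  shows "z = E \<cdot> z \<cdot> E \<oplus>\<^bsub>S\<^esub> E \<cdot> z \<cdot> F \<oplus>\<^bsub>S\<^esub> F \<cdot> z \<cdot> F"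
proof -
  note [simp] = assms image_closed
  have "z = (E \<oplus>\<^bsub>S\<^esub> F) \<cdot> z \<cdot> (E \<oplus>\<^bsub>S\<^esub> F)"
    by (simp add: image_idem_sum)
  also have "\<dots> = E \<cdot> z \<cdot> E \<oplus>\<^bsub>S\<^esub> E \<cdot> z \<cdot> F \<oplus>\<^bsub>S\<^esub> F \<cdot> z \<cdot> F"
    by (simp only: S.r_distr S.l_distr S.m_closed assms image_closed S.a_closed)
      (simp add: image_lower_corner S.a_assoc)
  finally show ?thesis .
qed

text \<open>Both sides are compared in the three Peirce corners that can be nonzero. Inserting \<open>e \<oplus> f\<close>
  between the factors writes a corner of a product as a sum of products of corners, and each of
  these is already known to be preserved.\<close>

lemma hom_mult:
  assumes "X \<in> carrier R" "Y \<in> carrier R"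
  shows "\<phi> (X \<otimes> Y) = \<phi> X \<cdot> \<phi> Y"
proof -
  note [simp] = assms idem_closed image_closed closed
  have ee: "E \<cdot> \<phi> (X \<otimes> Y) \<cdot> E = E \<cdot> (\<phi> X \<cdot> \<phi> Y) \<cdot> E"
  proof -
    have "E \<cdot> \<phi> (X \<otimes> Y) \<cdot> E = \<phi> ((e \<otimes> X \<otimes> e) \<otimes> (e \<otimes> Y \<otimes> e))"
      using insert_idem_sum[of e X Y e] by (simp add: corner_ee[symmetric] lower_corner)
    also have "\<dots> = E \<cdot> (\<phi> X \<cdot> \<phi> Y) \<cdot> E"
      using insert_image_idem_sum[of E "\<phi> X" "\<phi> Y" E]
      by (simp add: corner_mult_ee corner_ee image_lower_corner)
    finally show ?thesis .
  qed
  moreover have ff: "F \<cdot> \<phi> (X \<otimes> Y) \<cdot> F = F \<cdot> (\<phi> X \<cdot> \<phi> Y) \<cdot> F"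
  proof -
    have "F \<cdot> \<phi> (X \<otimes> Y) \<cdot> F = \<phi> ((f \<otimes> X \<otimes> f) \<otimes> (f \<otimes> Y \<otimes> f))"
      using insert_idem_sum[of f X Y f] by (simp add: corner_ff[symmetric] lower_corner)
    also have "\<dots> = F \<cdot> (\<phi> X \<cdot> \<phi> Y) \<cdot> F"
      using insert_image_idem_sum[of F "\<phi> X" "\<phi> Y" F]
      by (simp add: corner_mult_ff corner_ff image_lower_corner)
    finally show ?thesis .
  qed
  moreover have ef: "E \<cdot> \<phi> (X \<otimes> Y) \<cdot> F = E \<cdot> (\<phi> X \<cdot> \<phi> Y) \<cdot> F"
  proof -
    have "E \<cdot> \<phi> (X \<otimes> Y) \<cdot> F =
        \<phi> ((e \<otimes> X \<otimes> e) \<otimes> (e \<otimes> Y \<otimes> f)) \<oplus>\<^bsub>S\<^esub> \<phi> ((e \<otimes> X \<otimes> f) \<otimes> (f \<otimes> Y \<otimes> f))"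
      using insert_idem_sum[of e X Y f] by (simp add: corner_ef[symmetric] add[symmetric])
    also have "\<dots> = E \<cdot> (\<phi> X \<cdot> \<phi> Y) \<cdot> F"
      using insert_image_idem_sum[of E "\<phi> X" "\<phi> Y" F]
      by (simp add: module_mult_l module_mult_r corner_ee corner_ef corner_ff)
    finally show ?thesis .
  qed
  ultimately show ?thesis
    using peirce_decomposition[of "\<phi> (X \<otimes> Y)"] peirce_decomposition[of "\<phi> X \<cdot> \<phi> Y"] by simp
qed

end

section \<open>Generating series of families of maps\<close>

definition generating_series :: "(nat \<Rightarrow> 'r \<Rightarrow> 'r) \<Rightarrow> 'r \<Rightarrow> nat \<Rightarrow> 'r" where
  "generating_series \<tau> X = (\<lambda>n. \<tau> n X)"

context ring
begin

lemma generating_series_closed: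
  assumes "additive_family R \<tau>" "X \<in> carrier R"
  shows "generating_series \<tau> X \<in> carrier \<S>"
  using assms by (auto simp: additive_family_def hom_def generating_series_def power_series_simps)

lemma generating_series_add:
  assumes "additive_family R \<tau>" "X \<in> carrier R" "Y \<in> carrier R"
  shows "generating_series \<tau> (X \<oplus> Y) = generating_series \<tau> X \<oplus>\<^bsub>\<S>\<^esub> generating_series \<tau> Y"
  using assms by (auto simp: additive_family_def hom_def generating_series_def power_series_simps)

lemma generating_series_0:
  assumes "additive_family R \<tau>" "X \<in> carrier R"
  shows "generating_series \<tau> X 0 = X"
  using assms by (auto simp: additive_family_def generating_series_def)

lemma jordan_triple_map_generating_series:
  assumes "jordan_triple_higher_derivation R \<tau>"
  shows "jordan_triple_map R \<S> (generating_series \<tau>)"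
proof -
  interpret S: ring \<S> by (rule ring_series)
  have \<tau>: "additive_family R \<tau>"
    using assms by (simp add: jordan_triple_higher_derivation_def)
  show ?thesis
  proof unfold_locales
    fix X Y assume XY: "X \<in> carrier R" "Y \<in> carrier R"
    let ?T = "generating_series \<tau>"
    show "?T (X \<otimes> Y \<otimes> X) = ?T X \<otimes>\<^bsub>\<S>\<^esub> ?T Y \<otimes>\<^bsub>\<S>\<^esub> ?T X"
    proof
      fix n
      show "?T (X \<otimes> Y \<otimes> X) n = (?T X \<otimes>\<^bsub>\<S>\<^esub> ?T Y \<otimes>\<^bsub>\<S>\<^esub> ?T X) n"
        using assms XY
        by (subst series_triple_coeff)
          (simp_all add: generating_series_closed[OF \<tau>],
            simp add: jordan_triple_higher_derivation_def generating_series_def)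
    qed
  qed (auto simp: generating_series_closed[OF \<tau>] generating_series_add[OF \<tau>])
qed

text \<open>The cube of the image of \<open>\<one>\<close> is itself, and one factor cancels because its
  constant term is \<open>\<one>\<close>.\<close>

lemma unit_series_square_one:
  assumes "jordan_triple_map R \<S> T" "\<And>X. X \<in> carrier R \<Longrightarrow> T X 0 = X"
  shows "T \<one> \<otimes>\<^bsub>\<S>\<^esub> T \<one> = \<one>\<^bsub>\<S>\<^esub>"
proof -
  interpret S: ring \<S> by (rule ring_series)
  interpret T: jordan_triple_map R \<S> T by fact
  let ?u = "T \<one>"
  have u [simp]: "?u \<in> carrier \<S>"
    by (simp add: T.closed)
  have "?u \<otimes>\<^bsub>\<S>\<^esub> ?u \<otimes>\<^bsub>\<S>\<^esub> ?u = ?u"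
    using T.triple[of \<one> \<one>, symmetric] by simp
  then have "(?u \<otimes>\<^bsub>\<S>\<^esub> ?u \<ominus>\<^bsub>\<S>\<^esub> \<one>\<^bsub>\<S>\<^esub>) \<otimes>\<^bsub>\<S>\<^esub> ?u = \<zero>\<^bsub>\<S>\<^esub>"
    by (simp add: S.minus_eq S.l_distr S.l_minus S.r_neg)
  then have "?u \<otimes>\<^bsub>\<S>\<^esub> ?u \<ominus>\<^bsub>\<S>\<^esub> \<one>\<^bsub>\<S>\<^esub> = \<zero>\<^bsub>\<S>\<^esub>"
    by (rule series_cancel_const_one[rotated -1]) (simp_all add: assms(2))
  then show ?thesis
    by simp
qed

lemma unit_series_commutes:
  assumes "jordan_triple_map R \<S> T" "\<And>X. X \<in> carrier R \<Longrightarrow> T X 0 = X" "X \<in> carrier R"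
  shows "T \<one> \<otimes>\<^bsub>\<S>\<^esub> T X = T X \<otimes>\<^bsub>\<S>\<^esub> T \<one>"
proof -
  interpret S: ring \<S> by (rule ring_series)
  interpret T: jordan_triple_map R \<S> T by fact
  let ?u = "T \<one>"
  have [simp]: "?u \<in> carrier \<S>" "T X \<in> carrier \<S>"
    by (simp_all add: T.closed assms(3))
  have "?u \<otimes>\<^bsub>\<S>\<^esub> T X = ?u \<otimes>\<^bsub>\<S>\<^esub> (?u \<otimes>\<^bsub>\<S>\<^esub> T X \<otimes>\<^bsub>\<S>\<^esub> ?u)"
    using T.triple[of \<one> X, symmetric] assms(3) by simp
  also have "\<dots> = (?u \<otimes>\<^bsub>\<S>\<^esub> ?u) \<otimes>\<^bsub>\<S>\<^esub> (T X \<otimes>\<^bsub>\<S>\<^esub> ?u)"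
    by (simp add: S.m_assoc)
  also have "\<dots> = T X \<otimes>\<^bsub>\<S>\<^esub> ?u"
    by (simp add: unit_series_square_one[OF assms(1,2)])
  finally show ?thesis .
qed

text \<open>In the product of three normalized values the factor \<open>T \<one>\<close> occurs three times; two
  of these are moved together and cancel.\<close>

lemma jordan_triple_hom_normalized:
  assumes "jordan_triple_map R \<S> T" "\<And>X. X \<in> carrier R \<Longrightarrow> T X 0 = X"
  shows "jordan_triple_hom R \<S> (\<lambda>X. T X \<otimes>\<^bsub>\<S>\<^esub> T \<one>)"
proof -
  interpret S: ring \<S> by (rule ring_series)
  interpret T: jordan_triple_map R \<S> T by fact
  let ?u = "T \<one>"
  note [simp] = T.closed
  note uu = unit_series_square_one[OF assms]
  have uu': "?u \<otimes>\<^bsub>\<S>\<^esub> (?u \<otimes>\<^bsub>\<S>\<^esub> z) = z" if "z \<in> carrier \<S>" for z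
    using that uu by (simp add: S.m_assoc[symmetric])
  note comm = unit_series_commutes[OF assms]
  show ?thesis
  proof unfold_locales
    fix X Y assume [simp]: "X \<in> carrier R" "Y \<in> carrier R"
    show "T (X \<oplus> Y) \<otimes>\<^bsub>\<S>\<^esub> ?u = T X \<otimes>\<^bsub>\<S>\<^esub> ?u \<oplus>\<^bsub>\<S>\<^esub> T Y \<otimes>\<^bsub>\<S>\<^esub> ?u"
      by (simp add: T.add S.l_distr)
    have "T X \<otimes>\<^bsub>\<S>\<^esub> ?u \<otimes>\<^bsub>\<S>\<^esub> (T Y \<otimes>\<^bsub>\<S>\<^esub> ?u) \<otimes>\<^bsub>\<S>\<^esub> (T X \<otimes>\<^bsub>\<S>\<^esub> ?u)
        = T X \<otimes>\<^bsub>\<S>\<^esub> (?u \<otimes>\<^bsub>\<S>\<^esub> T Y) \<otimes>\<^bsub>\<S>\<^esub> (?u \<otimes>\<^bsub>\<S>\<^esub> T X) \<otimes>\<^bsub>\<S>\<^esub> ?u"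
      by (simp add: S.m_assoc)
    also have "\<dots> = T X \<otimes>\<^bsub>\<S>\<^esub> T Y \<otimes>\<^bsub>\<S>\<^esub> T X \<otimes>\<^bsub>\<S>\<^esub> ?u"
      by (simp add: comm[of Y]) (simp add: S.m_assoc uu')
    finally show "T (X \<otimes> Y \<otimes> X) \<otimes>\<^bsub>\<S>\<^esub> ?u =
        T X \<otimes>\<^bsub>\<S>\<^esub> ?u \<otimes>\<^bsub>\<S>\<^esub> (T Y \<otimes>\<^bsub>\<S>\<^esub> ?u) \<otimes>\<^bsub>\<S>\<^esub> (T X \<otimes>\<^bsub>\<S>\<^esub> ?u)"
      by (simp add: T.triple)
  qed (simp_all add: uu)
qed

end

context triangular_ring
begin

text \<open>The constant terms of \<open>\<phi> e\<close> and \<open>\<phi> f\<close> are \<open>e\<close> and \<open>f\<close>, so a lowest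
  coefficient of an element of a corner of the power series ring lies in the corresponding corner of \<open>R\<close>, where the
  hypotheses on \<open>e\<close> and \<open>f\<close> apply.\<close>

lemma triangular_jordan_hom_series:
  assumes "jordan_triple_hom R \<S> \<phi>" "\<And>X. X \<in> carrier R \<Longrightarrow> \<phi> X 0 = X"
  shows "triangular_jordan_hom R e f \<S> \<phi>"
proof -
  interpret S: ring \<S> by (rule ring_series)
  interpret jordan_triple_hom R \<S> \<phi> by fact
  note [simp] = closed idem_closed assms(2)
  have idem_series: "\<phi> e \<otimes>\<^bsub>\<S>\<^esub> \<phi> e = \<phi> e" "\<phi> f \<otimes>\<^bsub>\<S>\<^esub> \<phi> f = \<phi> f"
    using idempotent idem by auto
  have coeff: "x n \<in> carrier R" if "x \<in> carrier \<S>" for x n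
    using that by (rule series_coeff_closed)
  show ?thesis
  proof unfold_locales
    fix z assume z [simp]: "z \<in> carrier \<S>"
    let ?w = "\<phi> f \<otimes>\<^bsub>\<S>\<^esub> z \<otimes>\<^bsub>\<S>\<^esub> \<phi> e"
    have w: "\<phi> f \<otimes>\<^bsub>\<S>\<^esub> ?w \<otimes>\<^bsub>\<S>\<^esub> \<phi> e = ?w"
    proof -
      have "\<phi> f \<otimes>\<^bsub>\<S>\<^esub> ?w \<otimes>\<^bsub>\<S>\<^esub> \<phi> e
          = (\<phi> f \<otimes>\<^bsub>\<S>\<^esub> \<phi> f) \<otimes>\<^bsub>\<S>\<^esub> z \<otimes>\<^bsub>\<S>\<^esub> (\<phi> e \<otimes>\<^bsub>\<S>\<^esub> \<phi> e)"
        by (simp add: S.m_assoc)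
      then show ?thesis
        by (simp add: idem_series)
    qed
    show "?w = \<zero>\<^bsub>\<S>\<^esub>"
    proof (rule series_zeroI)
      fix n assume "\<And>k. k < n \<Longrightarrow> ?w k = \<zero>"
      then have "(\<phi> f \<otimes>\<^bsub>\<S>\<^esub> ?w \<otimes>\<^bsub>\<S>\<^esub> \<phi> e) n = f \<otimes> ?w n \<otimes> e"
        by (subst series_sandwich_lowest_coeff) simp_all
      then show "?w n = \<zero>"
        unfolding w by (simp add: lower_corner coeff)
    qed
  next
    fix z assume z [simp]: "z \<in> carrier \<S>" and corner: "z = \<phi> e \<otimes>\<^bsub>\<S>\<^esub> z \<otimes>\<^bsub>\<S>\<^esub> \<phi> e"
      and ann: "\<And>Y. Y \<in> carrier R \<Longrightarrow> z \<otimes>\<^bsub>\<S>\<^esub> \<phi> (e \<otimes> Y \<otimes> f) = \<zero>\<^bsub>\<S>\<^esub>"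
    show "z = \<zero>\<^bsub>\<S>\<^esub>"
    proof (rule series_zeroI)
      fix n assume low: "\<And>k. k < n \<Longrightarrow> z k = \<zero>"
      have zn: "z n = e \<otimes> z n \<otimes> e"
        using series_sandwich_lowest_coeff[of "\<phi> e" z "\<phi> e" n] low corner[symmetric] by simp
      have "z n \<otimes> (e \<otimes> Y \<otimes> f) = \<zero>" if "Y \<in> carrier R" for Y
        using series_lowest_coeff_l[of z "\<phi> (e \<otimes> Y \<otimes> f)" n] low ann[of Y] that
        by (simp add: power_series_simps(4))
      then show "z n = \<zero>"
        using corner_faithful_l[of "z n"] coeff[of z n] zn[symmetric] by simp
    qed
  next
    fix z assume z [simp]: "z \<in> carrier \<S>" and corner: "z = \<phi> f \<otimes>\<^bsub>\<S>\<^esub> z \<otimes>\<^bsub>\<S>\<^esub> \<phi> f"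
      and ann: "\<And>Y. Y \<in> carrier R \<Longrightarrow> \<phi> (e \<otimes> Y \<otimes> f) \<otimes>\<^bsub>\<S>\<^esub> z = \<zero>\<^bsub>\<S>\<^esub>"
    show "z = \<zero>\<^bsub>\<S>\<^esub>"
    proof (rule series_zeroI)
      fix n assume low: "\<And>k. k < n \<Longrightarrow> z k = \<zero>"
      have zn: "z n = f \<otimes> z n \<otimes> f"
        using series_sandwich_lowest_coeff[of "\<phi> f" z "\<phi> f" n] low corner[symmetric] by simp
      have "(e \<otimes> Y \<otimes> f) \<otimes> z n = \<zero>" if "Y \<in> carrier R" for Y
        using series_lowest_coeff_r[of "\<phi> (e \<otimes> Y \<otimes> f)" z n] low ann[of Y] that
        by (simp add: power_series_simps(4))
      then show "z n = \<zero>"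
        using corner_faithful_r[of "z n"] coeff[of z n] zn[symmetric] by simp
    qed
  qed
qed

text \<open>The witness is the normalized family \<open>\<rho>\<close>, not the given \<open>\<tau>\<close>, which need not be a
  higher derivation. The factor \<open>T \<one>\<close> that normalizes \<open>T X\<close> is supplied by the third factor of the
  triple identity for \<open>D (\<one> \<otimes> X \<otimes> \<one>)\<close>.\<close>

lemma generalized_higher_derivation_if_jordan_triple:
  assumes "generalized_jordan_triple_higher_derivation R \<delta>"
  shows "generalized_higher_derivation R \<delta>"
proof -
  interpret S: ring \<S> by (rule ring_series)
  obtain \<tau> where \<delta>: "additive_family R \<delta>"
    and jordan: "jordan_triple_higher_derivation R \<tau>"
    and \<delta>_triple: "\<And>n X Y. \<lbrakk>X \<in> carrier R; Y \<in> carrier R\<rbrakk> \<Longrightarrow> \<delta> n (X \<otimes> Y \<otimes> X) =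
      finsum R (\<lambda>(i, j, k). \<delta> i X \<otimes> \<tau> j Y \<otimes> \<tau> k X) {(i, j, k). i + j + k = n}"
    using assms unfolding generalized_jordan_triple_higher_derivation_def by blast
  have \<tau>: "additive_family R \<tau>"
    using jordan by (simp add: jordan_triple_higher_derivation_def)
  define T where "T = generating_series \<tau>"
  define D where "D = generating_series \<delta>"
  define \<sigma> where "\<sigma> X = T X \<otimes>\<^bsub>\<S>\<^esub> T \<one>" for X
  have T: "jordan_triple_map R \<S> T" and T0: "\<And>X. X \<in> carrier R \<Longrightarrow> T X 0 = X"
    unfolding T_def using jordan_triple_map_generating_series[OF jordan]
      generating_series_0[OF \<tau>] by auto
  have [simp]: "T X \<in> carrier \<S>" "D X \<in> carrier \<S>" if "X \<in> carrier R" for X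
    using that by (simp_all add: T_def D_def generating_series_closed \<tau> \<delta>)
  have \<sigma>0: "\<sigma> X 0 = X" if "X \<in> carrier R" for X
    using series_lowest_coeff_l[of "T X" "T \<one>" 0] that by (simp add: \<sigma>_def T0)
  interpret \<sigma>: jordan_triple_hom R \<S> \<sigma>
    unfolding \<sigma>_def by (rule jordan_triple_hom_normalized[OF T T0])
  interpret \<sigma>: triangular_jordan_hom R e f \<S> \<sigma>
    by (rule triangular_jordan_hom_series[OF \<sigma>.jordan_triple_hom_axioms \<sigma>0])
  have D: "D X = D \<one> \<otimes>\<^bsub>\<S>\<^esub> \<sigma> X" if [simp]: "X \<in> carrier R" for X
  proof
    fix n
    have "D X n = (D \<one> \<otimes>\<^bsub>\<S>\<^esub> T X \<otimes>\<^bsub>\<S>\<^esub> T \<one>) n"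
      using \<delta>_triple[of \<one> X n]
      by (subst series_triple_coeff) (simp_all add: D_def T_def generating_series_def
        generating_series_closed[OF \<tau>, unfolded generating_series_def]
        generating_series_closed[OF \<delta>, unfolded generating_series_def])
    then show "D X n = (D \<one> \<otimes>\<^bsub>\<S>\<^esub> \<sigma> X) n"
      by (simp add: \<sigma>_def S.m_assoc)
  qed
  define \<rho> where "\<rho> n X = \<sigma> X n" for n X
  have "additive_family R \<rho>"
    using \<sigma>.closed \<sigma>.add \<sigma>0
    by (auto simp: additive_family_def hom_def \<rho>_def power_series_simps)
  then have "higher_derivation R \<rho>"
    by (auto simp: higher_derivation_def \<rho>_def \<sigma>.hom_mult power_series_simps)
  moreover have "\<delta> n (X \<otimes> Y) = finsum R (\<lambda>(i, j). \<delta> i X \<otimes> \<rho> j Y) {(i, j). i + j = n}"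
    if [simp]: "X \<in> carrier R" "Y \<in> carrier R" for n X Y
  proof -
    have "D (X \<otimes> Y) = D \<one> \<otimes>\<^bsub>\<S>\<^esub> \<sigma> X \<otimes>\<^bsub>\<S>\<^esub> \<sigma> Y"
      by (simp add: D[of "X \<otimes> Y"] \<sigma>.hom_mult S.m_assoc \<sigma>.closed)
    then have "D (X \<otimes> Y) n = (D X \<otimes>\<^bsub>\<S>\<^esub> \<sigma> Y) n"
      by (simp add: D[of X])
    then show ?thesis
      by (simp add: power_series_simps D_def generating_series_def \<rho>_def)
  qed
  ultimately show ?thesis
    using \<delta> unfolding generalized_higher_derivation_def by blast
qed

end

section \<open>Triangular matrices\<close>

lemma (in bimodule) triangular_ring_Tri:
  assumes "left_faithful A M" "right_faithful B M"
  shows "triangular_ring (Tri A M B)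
    (\<one>\<^bsub>A\<^esub>, \<zero>\<^bsub>M\<^esub>, \<zero>\<^bsub>B\<^esub>) (\<zero>\<^bsub>A\<^esub>, \<zero>\<^bsub>M\<^esub>, \<one>\<^bsub>B\<^esub>)"
proof -
  interpret T: ring "Tri A M B" by (rule ring_Tri)
  have zero_smult: "\<zero>\<^bsub>A\<^esub> \<odot>\<^bsub>M\<^esub> x = \<zero>\<^bsub>M\<^esub>" if "x \<in> carrier M" for x
    using smult_l_distr[of "\<zero>\<^bsub>A\<^esub>" "\<zero>\<^bsub>A\<^esub>" x] smult_closed[of "\<zero>\<^bsub>A\<^esub>" x] that
    by (metis A.l_zero A.zero_closed M.add.l_cancel_one')
  have rsmult_zero_r: "x \<odot>\<^sub>r\<^bsub>M\<^esub> \<zero>\<^bsub>B\<^esub> = \<zero>\<^bsub>M\<^esub>" if "x \<in> carrier M" for x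
    using rsmult_r_distr[of x "\<zero>\<^bsub>B\<^esub>" "\<zero>\<^bsub>B\<^esub>"] rsmult_closed[of x "\<zero>\<^bsub>B\<^esub>"] that
    by (metis B.l_zero B.zero_closed M.add.l_cancel_one')
  note simps = Tri_def smult_zero rsmult_zero zero_smult rsmult_zero_r smult_one rsmult_one
    smult_closed rsmult_closed
  show ?thesis
  proof unfold_locales
    fix X
    let ?e = "(\<one>\<^bsub>A\<^esub>, \<zero>\<^bsub>M\<^esub>, \<zero>\<^bsub>B\<^esub>)" and ?f = "(\<zero>\<^bsub>A\<^esub>, \<zero>\<^bsub>M\<^esub>, \<one>\<^bsub>B\<^esub>)"
    assume X: "X \<in> carrier (Tri A M B)"
    obtain a x b where [simp]: "X = (a, x, b)" by (cases X)
    show "?f \<otimes>\<^bsub>Tri A M B\<^esub> X \<otimes>\<^bsub>Tri A M B\<^esub> ?e = \<zero>\<^bsub>Tri A M B\<^esub>"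
      using X by (auto simp: simps)
    {
      assume ann: "\<And>Y. Y \<in> carrier (Tri A M B) \<Longrightarrow>
        (?e \<otimes>\<^bsub>Tri A M B\<^esub> X \<otimes>\<^bsub>Tri A M B\<^esub> ?e) \<otimes>\<^bsub>Tri A M B\<^esub>
        (?e \<otimes>\<^bsub>Tri A M B\<^esub> Y \<otimes>\<^bsub>Tri A M B\<^esub> ?f) = \<zero>\<^bsub>Tri A M B\<^esub>"
      have "a \<odot>\<^bsub>M\<^esub> y = \<zero>\<^bsub>M\<^esub>" if "y \<in> carrier M" for y
        using ann[of "(\<zero>\<^bsub>A\<^esub>, y, \<zero>\<^bsub>B\<^esub>)"] that X by (simp add: simps)
      then have "a = \<zero>\<^bsub>A\<^esub>"
        using assms(1) X by (auto simp: left_faithful_def Tri_def)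
      then show "?e \<otimes>\<^bsub>Tri A M B\<^esub> X \<otimes>\<^bsub>Tri A M B\<^esub> ?e = \<zero>\<^bsub>Tri A M B\<^esub>"
        using X by (auto simp: simps)
    next
      assume ann: "\<And>Y. Y \<in> carrier (Tri A M B) \<Longrightarrow>
        (?e \<otimes>\<^bsub>Tri A M B\<^esub> Y \<otimes>\<^bsub>Tri A M B\<^esub> ?f) \<otimes>\<^bsub>Tri A M B\<^esub>
        (?f \<otimes>\<^bsub>Tri A M B\<^esub> X \<otimes>\<^bsub>Tri A M B\<^esub> ?f) = \<zero>\<^bsub>Tri A M B\<^esub>"
      have "y \<odot>\<^sub>r\<^bsub>M\<^esub> b = \<zero>\<^bsub>M\<^esub>" if "y \<in> carrier M" for y
        using ann[of "(\<zero>\<^bsub>A\<^esub>, y, \<zero>\<^bsub>B\<^esub>)"] that X by (simp add: simps)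
      then have "b = \<zero>\<^bsub>B\<^esub>"
        using assms(2) X by (auto simp: right_faithful_def Tri_def)
      then show "?f \<otimes>\<^bsub>Tri A M B\<^esub> X \<otimes>\<^bsub>Tri A M B\<^esub> ?f = \<zero>\<^bsub>Tri A M B\<^esub>"
        using X by (auto simp: simps)
    }
  qed (auto simp: simps)
qed

theorem theorem3p2:
  fixes A :: "('a, 'u) ring_scheme"
    and B :: "('b, 'v) ring_scheme"
    and M :: "('a, 'b, 'm, 'w) bimodule_scheme"
    and \<delta> :: "nat \<Rightarrow> 'a \<times> 'm \<times> 'b \<Rightarrow> 'a \<times> 'm \<times> 'b"
  assumes "ring A"
    and "ring B"
    and "bimodule A B M"
    and "left_faithful A M"
    and "right_faithful B M"
    and "generalized_jordan_triple_higher_derivation (Tri A M B) \<delta>"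
  shows "generalized_higher_derivation (Tri A M B) \<delta>"
proof -
  interpret bimodule A B M by fact
  show ?thesis
    by (rule triangular_ring.generalized_higher_derivation_if_jordan_triple
        [OF triangular_ring_Tri[OF assms(4,5)] assms(6)])
qed

end
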